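(* Let $\phi\in\mathbb{R}^{S\times d_\phi}$ and $\psi\in\mathbb{R}^{S\times d_\psi}$ satisfy $\phi^\top\phi=I$ and $\psi^\top\psi=I$. For any reward function $r\in\mathbb{R}^S$, let $\omega_r:=(\psi^\top\psi)^{-1}\psi^\top r$ be the linear regression weight for the representation $\psi$. Then, for any collection $\{T_z\}_{z\in\mathcal{Z}}$ with $T_z\in\mathbb{R}^{d_\phi\times d_\psi}$, $$\max_{r\in\mathbb{R}^S:\ \|r\|_2\le1}\ \mathbb{E}_{z}\Big[\sum_{s}\big(V_r^{\pi_z}(s)-\phi(s)^\top T_z\,\omega_r\big)^2\Big]\ \le\ 2\,\mathcal{L}_{\mathrm{SM}}(\phi,T_z,\psi).$$ Moreover, there is a constant $c$, not depending on $\phi$, $\psi$ or $\{T_z\}_z$, such that $\mathcal{L}_{\mathrm{SM}}(\phi,T_z,\psi)\le c\,\mathcal{L}_{\mathrm{fw}}(\phi,T_z,\psi)$ and $\mathcal{L}_{\mathrm{SM}}(\phi,T_z,\psi)\le c\,\mathcal{L}_{\mathrm{bw}}(\phi,T_z^\top,\psi)$.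
   Context: Setting: a finite Markov decision process with $S$ states, transition probabilities $P(s'\mid s,a)$ and discount factor $\gamma\in[0,1)$; a finite index set $\mathcal{Z}$ with a probability distribution $p$ (expectations $\mathbb{E}_z$ are over $z\sim p$); policies $\pi_z$, $z\in\mathcal{Z}$. $P^{\pi_z}\in\mathbb{R}^{S\times S}$ is the row-stochastic matrix with entries $P^{\pi_z}(s'\mid s)=P(s'\mid s,\pi_z(s))$ in row $s$, column $s'$. $M^{\pi_z}=\sum_{t\ge0}\gamma^t(P^{\pi_z})^{t+1}$ is the (unnormalized) successor measure matrix. The value function of $\pi_z$ for reward $r$ is $V_r^{\pi_z}(s)=\mathbb{E}\big[\sum_{t\ge0}\gamma^t r(s_{t+1})\mid s_0=s,\pi_z\big]$, i.e. $V_r^{\pi_z}=M^{\pi_z}r$. $\phi(s)\in\mathbb{R}^{d_\phi}$ denotes row $s$ of $\phi$ as a column vector; $\|\cdot\|_F$ is the Frobenius norm. Losses (the argument $T_z$ stands for the whole collection $\{T_z\}_z$): $$\mathcal{L}_{\mathrm{SM}}(\phi,T_z,\psi)=\tfrac12\,\mathbb{E}_z\|\phi T_z\psi^\top-M^{\pi_z}\|_F^2,\qquad T_z\in\mathbb{R}^{d_\phi\times d_\psi},$$ $$\mathcal{L}_{\mathrm{fw}}(\phi,T_z,\psi)=\tfrac12\,\mathbb{E}_z\big\|\phi T_z\psi^\top-P^{\pi_z}-\gamma P^{\pi_z}\phi T_z\psi^\top\big\|_F^2,\qquad T_z\in\mathbb{R}^{d_\phi\times d_\psi},$$ $$\mathcal{L}_{\mathrm{bw}}(\phi,T_z,\psi)=\tfrac12\,\mathbb{E}_z\big\|\psi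 T_z\phi^\top-(P^{\pi_z})^\top-\gamma(P^{\pi_z})^\top\psi T_z\phi^\top\big\|_F^2,\qquad T_z\in\mathbb{R}^{d_\psi\times d_\phi}.$$ (Stop-gradient operators in the original definitions of $\mathcal{L}_{\mathrm{fw}},\mathcal{L}_{\mathrm{bw}}$ do not affect the values and are omitted.) *)

theory Defs
  imports "HOL-Analysis.Analysis" "HOL-Probability.Probability"
begin

text \<open>The Markov decision process is given by its transition kernel
  \<open>P :: 's \<Rightarrow> 'a \<Rightarrow> 's pmf\<close> on the finite type \<open>'s\<close> of states; policies are deterministic
  maps \<open>'s \<Rightarrow> 'a\<close>. An \<open>m \<times> n\<close> matrix is an element of \<open>real ^ 'n ^ 'm\<close>; the library norm on this
  type is the Frobenius norm, and \<open>transpose\<close>, \<open>**\<close>, \<open>*v\<close> are the usual matrix operations.\<close>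

text \<open>The library's \<open>^\<close> on \<open>real ^ 'n ^ 'n\<close> is the entrywise power, hence a separate definition.\<close>

primrec matpow :: "real ^ 'n ^ 'n \<Rightarrow> nat \<Rightarrow> real ^ 'n ^ 'n" where
  "matpow A 0 = mat 1"
| "matpow A (Suc n) = A ** matpow A n"

definition transition_matrix ::
  "('s \<Rightarrow> 'a \<Rightarrow> 's pmf) \<Rightarrow> ('s \<Rightarrow> 'a) \<Rightarrow> real ^ 's ^ 's::finite" where
  "transition_matrix P \<pi> = (\<chi> s s'. pmf (P s (\<pi> s)) s')"

definition successor_measure ::
  "('s \<Rightarrow> 'a \<Rightarrow> 's pmf) \<Rightarrow> real \<Rightarrow> ('s \<Rightarrow> 'a) \<Rightarrow> real ^ 's ^ 's::finite" where
  "successor_measure P \<gamma> \<pi> = (\<Sum>t. \<gamma> ^ t *\<^sub>R matpow (transition_matrix P \<pi>) (t + 1))"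

text \<open>The law of the state trajectory \<open>s\<^sub>0, s\<^sub>1, \<dots>\<close> started in \<open>s\<close> and following \<open>\<pi>\<close>, obtained from
  the Ionescu-Tulcea theorem: \<open>s\<^sub>0 = s\<close>, and given \<open>s\<^sub>0, \<dots>, s\<^sub>t\<close> the state \<open>s\<^sub>t\<^sub>+\<^sub>1\<close> has law
  \<open>P s\<^sub>t (\<pi> s\<^sub>t)\<close>.\<close>

definition trajectory_step ::
  "('s \<Rightarrow> 'a \<Rightarrow> 's pmf) \<Rightarrow> ('s \<Rightarrow> 'a) \<Rightarrow> 's \<Rightarrow> nat \<Rightarrow> (nat \<Rightarrow> 's) \<Rightarrow> 's measure" where
  "trajectory_step P \<pi> s n \<omega> =
     measure_pmf (case n of 0 \<Rightarrow> return_pmf s | Suc t \<Rightarrow> P (\<omega> t) (\<pi> (\<omega> t)))"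

definition trajectory_measure ::
  "('s::finite \<Rightarrow> 'a \<Rightarrow> 's pmf) \<Rightarrow> ('s \<Rightarrow> 'a) \<Rightarrow> 's \<Rightarrow> (nat \<Rightarrow> 's) measure" where
  "trajectory_measure P \<pi> s =
     projective_family.lim UNIV
       (Ionescu_Tulcea.CI (trajectory_step P \<pi> s) (\<lambda>_. count_space UNIV)) (\<lambda>_. count_space UNIV)"

definition value_function ::
  "('s::finite \<Rightarrow> 'a \<Rightarrow> 's pmf) \<Rightarrow> real \<Rightarrow> ('s \<Rightarrow> 'a) \<Rightarrow> real ^ 's \<Rightarrow> 's \<Rightarrow> real" where
  "value_function P \<gamma> \<pi> r s =
     (\<integral>\<omega>. (\<Sum>t. \<gamma> ^ t * r $ \<omega> (t + 1)) \<partial>trajectory_measure P \<pi> s)"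

text \<open>The linear-regression weight \<open>\<omega>\<^sub>r\<close> of a reward \<open>r\<close> for the representation \<open>\<psi>\<close>.\<close>

definition regression_weight :: "real ^ 'e ^ 's \<Rightarrow> real ^ 's \<Rightarrow> real ^ 'e" where
  "regression_weight \<psi> r = matrix_inv (transpose \<psi> ** \<psi>) *v (transpose \<psi> *v r)"

definition value_error ::
  "('s::finite \<Rightarrow> 'a \<Rightarrow> 's pmf) \<Rightarrow> real \<Rightarrow> 'z pmf \<Rightarrow> ('z \<Rightarrow> 's \<Rightarrow> 'a) \<Rightarrow>
   real ^ 'd ^ 's \<Rightarrow> ('z \<Rightarrow> real ^ 'e ^ 'd) \<Rightarrow> real ^ 'e ^ 's \<Rightarrow> real ^ 's \<Rightarrow> real" where
  "value_error P \<gamma> p \<pi> \<phi> T \<psi> r =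
     measure_pmf.expectation p (\<lambda>z. \<Sum>s\<in>UNIV.
       (value_function P \<gamma> (\<pi> z) r s - row s \<phi> \<bullet> (T z *v regression_weight \<psi> r))\<^sup>2)"

definition loss_SM ::
  "('s::finite \<Rightarrow> 'a \<Rightarrow> 's pmf) \<Rightarrow> real \<Rightarrow> 'z pmf \<Rightarrow> ('z \<Rightarrow> 's \<Rightarrow> 'a) \<Rightarrow>
   real ^ 'd ^ 's \<Rightarrow> ('z \<Rightarrow> real ^ 'e ^ 'd) \<Rightarrow> real ^ 'e ^ 's \<Rightarrow> real" where
  "loss_SM P \<gamma> p \<pi> \<phi> T \<psi> =
     1 / 2 * measure_pmf.expectation p (\<lambda>z.
       (norm (\<phi> ** T z ** transpose \<psi> - successor_measure P \<gamma> (\<pi> z)))\<^sup>2)"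

definition loss_fw ::
  "('s::finite \<Rightarrow> 'a \<Rightarrow> 's pmf) \<Rightarrow> real \<Rightarrow> 'z pmf \<Rightarrow> ('z \<Rightarrow> 's \<Rightarrow> 'a) \<Rightarrow>
   real ^ 'd ^ 's \<Rightarrow> ('z \<Rightarrow> real ^ 'e ^ 'd) \<Rightarrow> real ^ 'e ^ 's \<Rightarrow> real" where
  "loss_fw P \<gamma> p \<pi> \<phi> T \<psi> =
     1 / 2 * measure_pmf.expectation p (\<lambda>z.
       (norm (\<phi> ** T z ** transpose \<psi> - transition_matrix P (\<pi> z)
          - \<gamma> *\<^sub>R (transition_matrix P (\<pi> z) ** \<phi> ** T z ** transpose \<psi>)))\<^sup>2)"

definition loss_bw ::
  "('s::finite \<Rightarrow> 'a \<Rightarrow> 's pmf) \<Rightarrow> real \<Rightarrow> 'z pmf \<Rightarrow> ('z \<Rightarrow> 's \<Rightarrow> 'a) \<Rightarrow>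
   real ^ 'd ^ 's \<Rightarrow> ('z \<Rightarrow> real ^ 'd ^ 'e) \<Rightarrow> real ^ 'e ^ 's \<Rightarrow> real" where
  "loss_bw P \<gamma> p \<pi> \<phi> T \<psi> =
     1 / 2 * measure_pmf.expectation p (\<lambda>z.
       (norm (\<psi> ** T z ** transpose \<phi> - transpose (transition_matrix P (\<pi> z))
          - \<gamma> *\<^sub>R (transpose (transition_matrix P (\<pi> z)) ** \<psi> ** T z ** transpose \<phi>)))\<^sup>2)"

end

theory Submission
  imports Defs
begin

text \<open>Write \<open>A\<close> for the transition matrix of a policy, \<open>M\<close> for its successor measure and
  \<open>X = \<phi> T \<psi>\<^sup>T\<close>. Since \<open>\<omega>\<^sub>r = \<psi>\<^sup>T r\<close> and \<open>V\<^sub>r = M r\<close>, the value error is the mean of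
  \<open>\<parallel>(M - X) r\<parallel>\<^sup>2 \<le> \<parallel>M - X\<parallel>\<^sub>F\<^sup>2 \<parallel>r\<parallel>\<^sup>2\<close>; it is continuous in \<open>r\<close>, so its maximum over the unit ball is
  attained. For the second part, \<open>M = A + \<gamma> A M = A + \<gamma> M A\<close> makes the forward and the transposed
  backward residuals equal to \<open>(I - \<gamma> A) (X - M)\<close> and \<open>(X - M) (I - \<gamma> A)\<close>, and the inverse
  \<open>I + \<gamma> M\<close> of \<open>I - \<gamma> A\<close> does not depend on \<open>\<phi>\<close>, \<open>\<psi>\<close> and \<open>T\<close>.\<close>

subsection \<open>The Frobenius norm\<close>

text \<open>Cauchy-Schwarz in each row; the Frobenius norm is the Euclidean norm of the vector of
  row norms.\<close>

lemma norm_matrix_vector_mult_le: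
  fixes A :: "real ^ 'n ^ 'm"
  shows "norm (A *v x) \<le> norm A * norm x"
proof -
  have "norm (A *v x) \<le> L2_set (\<lambda>i. norm (A $ i) * norm x) UNIV"
    unfolding norm_vec_def[of "A *v x"]
    by (intro L2_set_mono)
      (simp_all add: matrix_vector_mul_component Cauchy_Schwarz_ineq2)
  also have "\<dots> = norm A * norm x"
    by (simp add: norm_vec_def[of A] L2_set_left_distrib)
  finally show ?thesis .
qed

lemma norm_transpose:
  fixes A :: "real ^ 'n ^ 'm"
  shows "norm (transpose A) = norm A"
proof -
  have "(norm (transpose A))\<^sup>2 = (norm A)\<^sup>2"
    by (simp add: power2_norm_eq_inner inner_vec_def transpose_def) (rule sum.swap)
  then show ?thesis
    by (simp add: power2_eq_iff_nonneg)
qed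

text \<open>Row \<open>i\<close> of \<open>A ** B\<close> is the transpose of \<open>B\<close>
  applied to row \<open>i\<close> of \<open>A\<close>, so the matrix-vector bound, used row by row,
  gives submultiplicativity.\<close>

lemma norm_matrix_matrix_mult_le:
  fixes A :: "real ^ 'n ^ 'm" and B :: "real ^ 'k ^ 'n"
  shows "norm (A ** B) \<le> norm A * norm B"
proof -
  have row: "(A ** B) $ i = transpose B *v A $ i" for i
    by (simp add: vec_eq_iff matrix_matrix_mult_def matrix_vector_mult_def transpose_def mult.commute
        del: transpose_matrix_vector)
  have "norm (A ** B) \<le> L2_set (\<lambda>i. norm (A $ i) * norm B) UNIV"
    unfolding norm_vec_def[of "A ** B"]
    by (intro L2_set_mono)
      (metis row norm_matrix_vector_mult_le norm_transpose mult.commute, simp)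
  also have "\<dots> = norm A * norm B"
    by (simp add: norm_vec_def[of A] L2_set_left_distrib)
  finally show ?thesis .
qed

lemma norm_le_sum_abs_entries:
  fixes A :: "real ^ 'n ^ 'm"
  shows "norm A \<le> (\<Sum>i\<in>UNIV. \<Sum>j\<in>UNIV. \<bar>A $ i $ j\<bar>)"
proof -
  have "norm A \<le> (\<Sum>i\<in>UNIV. norm (A $ i))"
    unfolding norm_vec_def[of A] by (intro L2_set_le_sum) simp
  also have "\<dots> \<le> (\<Sum>i\<in>UNIV. \<Sum>j\<in>UNIV. \<bar>A $ i $ j\<bar>)"
    by (intro sum_mono norm_le_l1_cart)
  finally show ?thesis .
qed

text \<open>Boundedness is what lets a fixed factor be pulled out of the Neumann series; linearity
  also supplies the algebraic rules collected below.\<close>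

lemma bounded_linear_matrix_mult_left:
  fixes A :: "real ^ 'n ^ 'm"
  shows "bounded_linear (\<lambda>B :: real ^ 'k ^ 'n. A ** B)"
proof (rule bounded_linear_intro[where K="norm A"])
  show "norm (A ** B) \<le> norm B * norm A" for B :: "real ^ 'k ^ 'n"
    using norm_matrix_matrix_mult_le[of A B] by (simp add: mult.commute)
qed (simp_all add: matrix_add_ldistrib matrix_scalar_ac flip: scalar_matrix_assoc)

lemma bounded_linear_matrix_mult_right:
  fixes B :: "real ^ 'k ^ 'n"
  shows "bounded_linear (\<lambda>A :: real ^ 'n ^ 'm. A ** B)"
proof (rule bounded_linear_intro[where K="norm B"])
  show "norm (A ** B) \<le> norm A * norm B" for A :: "real ^ 'n ^ 'm"
    by (rule norm_matrix_matrix_mult_le)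
qed (simp_all add: matrix_matrix_mult_def vec_eq_iff sum.distrib distrib_right sum_distrib_left
      mult.assoc)

lemmas matrix_mult_diff_left = linear_diff[OF bounded_linear.linear[OF bounded_linear_matrix_mult_left]]
lemmas matrix_mult_diff_right = linear_diff[OF bounded_linear.linear[OF bounded_linear_matrix_mult_right]]
lemmas matrix_mult_add_right = linear_add[OF bounded_linear.linear[OF bounded_linear_matrix_mult_right]]
lemmas matrix_mult_scaleR_left = linear_scale[OF bounded_linear.linear[OF bounded_linear_matrix_mult_left]]
lemmas matrix_mult_scaleR_right = linear_scale[OF bounded_linear.linear[OF bounded_linear_matrix_mult_right]]

lemma transpose_diff: "transpose (A - B) = transpose A - transpose (B :: real ^ 'n ^ 'm)"
  by (simp add: transpose_def vec_eq_iff)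

subsection \<open>The Neumann series of a stochastic matrix\<close>

definition row_stochastic :: "real ^ 'n ^ 'n \<Rightarrow> bool" where
  "row_stochastic A \<longleftrightarrow> (\<forall>i j. 0 \<le> A $ i $ j) \<and> (\<forall>i. (\<Sum>j\<in>UNIV. A $ i $ j) = 1)"

lemma row_stochastic_transition_matrix: "row_stochastic (transition_matrix P \<pi>)"
  by (simp add: row_stochastic_def transition_matrix_def sum_pmf_eq_1)

lemma row_stochastic_mult:
  assumes "row_stochastic A" "row_stochastic B"
  shows "row_stochastic (A ** B)"
proof -
  have "(\<Sum>j\<in>UNIV. (A ** B) $ i $ j) = 1" for i
  proof -
    have "(\<Sum>j\<in>UNIV. (A ** B) $ i $ j) = (\<Sum>k\<in>UNIV. A $ i $ k * (\<Sum>j\<in>UNIV. B $ k $ j))"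
      unfolding matrix_matrix_mult_def by (simp add: sum_distrib_left) (rule sum.swap)
    then show ?thesis
      using assms by (simp add: row_stochastic_def)
  qed
  then show ?thesis
    using assms by (simp add: row_stochastic_def matrix_matrix_mult_def sum_nonneg)
qed

lemma row_stochastic_matpow: "row_stochastic A \<Longrightarrow> row_stochastic (matpow A n)"
  by (induction n) (simp_all add: row_stochastic_mult, simp add: row_stochastic_def mat_def)

text \<open>Each row has absolute sum 1. The bound is the same for all stochastic matrices, hence
  for all powers of one of them, which gives the Neumann series a geometric majorant.\<close>

lemma norm_row_stochastic_le:
  assumes "row_stochastic (A :: real ^ 'n ^ 'n)"
  shows "norm A \<le> real CARD('n)"
  using norm_le_sum_abs_entries[of A] assms by (simp add: row_stochastic_def)

lemma matpow_commute: "matpow A n ** A = A ** matpow A n"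
  by (induction n) (simp_all add: matrix_mul_assoc[symmetric])

context
  fixes A :: "real ^ 'n ^ 'n" and \<gamma> :: real
  assumes A: "row_stochastic A" and \<gamma>: "0 \<le> \<gamma>" "\<gamma> < 1"
begin

lemma summable_Neumann: "summable (\<lambda>t. \<gamma> ^ t *\<^sub>R matpow A (t + 1))"
proof (rule summable_comparison_test')
  show "summable (\<lambda>t. \<gamma> ^ t * real CARD('n))"
    using \<gamma> by (intro summable_mult2 summable_geometric) simp
  show "norm (\<gamma> ^ t *\<^sub>R matpow A (t + 1)) \<le> \<gamma> ^ t * real CARD('n)" if "0 \<le> t" for t
    unfolding norm_scaleR using \<gamma>
    by (intro mult_mono norm_row_stochastic_le row_stochastic_matpow A) auto
qed

text \<open>The term \<open>t = 0\<close> is \<open>A\<close>. Every later term contains one more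
  factor \<gamma> and one more factor \<open>A\<close>, which can be taken out on either side
  because powers of \<open>A\<close> commute with \<open>A\<close>.\<close>

lemma Neumann_eq:
  fixes M defines "M \<equiv> (\<Sum>t. \<gamma> ^ t *\<^sub>R matpow A (t + 1))"
  shows "M = A + \<gamma> *\<^sub>R (A ** M)" and "M = A + \<gamma> *\<^sub>R (M ** A)"
proof -
  have split: "M = A + (\<Sum>t. \<gamma> ^ Suc t *\<^sub>R matpow A (Suc t + 1))"
    unfolding M_def using suminf_split_head[OF summable_Neumann] by simp
  have "(\<Sum>t. \<gamma> ^ Suc t *\<^sub>R matpow A (Suc t + 1)) =
      (\<Sum>t. \<gamma> *\<^sub>R (A ** (\<gamma> ^ t *\<^sub>R matpow A (t + 1))))"
    by (simp add: matrix_mult_scaleR_left)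
  also have "\<dots> = \<gamma> *\<^sub>R (A ** M)"
    unfolding M_def
    by (intro bounded_linear.suminf[symmetric] summable_Neumann
        bounded_linear_compose[OF bounded_linear_scaleR_right] bounded_linear_matrix_mult_left)
  finally show "M = A + \<gamma> *\<^sub>R (A ** M)"
    using split by simp
  have "(\<Sum>t. \<gamma> ^ Suc t *\<^sub>R matpow A (Suc t + 1)) =
      (\<Sum>t. \<gamma> *\<^sub>R ((\<gamma> ^ t *\<^sub>R matpow A (t + 1)) ** A))"
    by (simp add: matrix_mult_scaleR_right matpow_commute matrix_mul_assoc[symmetric])
  also have "\<dots> = \<gamma> *\<^sub>R (M ** A)"
    unfolding M_def
    by (intro bounded_linear.suminf[symmetric] summable_Neumann
        bounded_linear_compose[OF bounded_linear_scaleR_right] bounded_linear_matrix_mult_right)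
  finally show "M = A + \<gamma> *\<^sub>R (M ** A)"
    using split by simp
qed

lemma Bellman_residual:
  fixes M X defines "M \<equiv> (\<Sum>t. \<gamma> ^ t *\<^sub>R matpow A (t + 1))"
  shows "(mat 1 + \<gamma> *\<^sub>R M) ** (X - A - \<gamma> *\<^sub>R (A ** X)) = X - M"
    and "(X - A - \<gamma> *\<^sub>R (X ** A)) ** (mat 1 + \<gamma> *\<^sub>R M) = X - M"
proof -
  have AM: "\<gamma> *\<^sub>R (A ** M) = M - A" and MA: "\<gamma> *\<^sub>R (M ** A) = M - A"
    using Neumann_eq unfolding M_def by (simp_all add: algebra_simps)
  \<comment> \<open>The one product with two explicit factors \<gamma>. Replacing
    \<open>\<gamma> *\<^sub>R (M ** A)\<close> by \<open>M - A\<close> makes it cancel both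
    remaining terms that multiply \<open>X\<close> by \<open>M\<close> or \<open>A\<close>.\<close>
  have "(\<gamma> *\<^sub>R M) ** (\<gamma> *\<^sub>R (A ** X)) = \<gamma> *\<^sub>R ((\<gamma> *\<^sub>R (M ** A)) ** X)"
    by (simp add: matrix_mult_scaleR_left matrix_mult_scaleR_right matrix_mul_assoc)
  also have "\<dots> = \<gamma> *\<^sub>R (M ** X) - \<gamma> *\<^sub>R (A ** X)"
    by (simp add: MA matrix_mult_diff_right scaleR_diff_right)
  finally have *: "(\<gamma> *\<^sub>R M) ** (\<gamma> *\<^sub>R (A ** X)) = \<gamma> *\<^sub>R (M ** X) - \<gamma> *\<^sub>R (A ** X)" .
  show "(mat 1 + \<gamma> *\<^sub>R M) ** (X - A - \<gamma> *\<^sub>R (A ** X)) = X - M"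
    unfolding matrix_mult_add_right matrix_mult_diff_left *
    by (simp add: matrix_mult_scaleR_right MA)
  have "(\<gamma> *\<^sub>R (X ** A)) ** (\<gamma> *\<^sub>R M) = \<gamma> *\<^sub>R (X ** (\<gamma> *\<^sub>R (A ** M)))"
    by (simp add: matrix_mult_scaleR_left matrix_mult_scaleR_right matrix_mul_assoc)
  also have "\<dots> = \<gamma> *\<^sub>R (X ** M) - \<gamma> *\<^sub>R (X ** A)"
    by (simp add: AM matrix_mult_diff_left scaleR_diff_right)
  finally have *: "(\<gamma> *\<^sub>R (X ** A)) ** (\<gamma> *\<^sub>R M) = \<gamma> *\<^sub>R (X ** M) - \<gamma> *\<^sub>R (X ** A)" .
  show "(X - A - \<gamma> *\<^sub>R (X ** A)) ** (mat 1 + \<gamma> *\<^sub>R M) = X - M"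
    unfolding matrix_add_ldistrib matrix_mult_diff_right *
    by (simp add: matrix_mult_scaleR_left AM)
qed

end

subsection \<open>The law of the trajectory\<close>

text \<open>The first kernel is constant and each later one reads only the last coordinate of the
  history, so measurability reduces to that of a coordinate map followed by a map on a discrete
  space.\<close>

lemma Ionescu_Tulcea_trajectory_step:
  "Ionescu_Tulcea (trajectory_step P \<pi> s) (\<lambda>_. count_space (UNIV :: 's::finite set))"
proof (rule Ionescu_Tulcea.intro)
  show "trajectory_step P \<pi> s n \<in>
      PiM {0..<n} (\<lambda>_. count_space UNIV) \<rightarrow>\<^sub>M subprob_algebra (count_space UNIV)" for n
  proof (cases n)
    case 0
    then show ?thesis
      by (simp add: trajectory_step_def[abs_def] measure_pmf_in_subprob_space)
  next
    case (Suc t)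
    have "(\<lambda>\<omega>. \<omega> t) \<in> PiM {0..<n} (\<lambda>_. count_space UNIV) \<rightarrow>\<^sub>M count_space (UNIV :: 's set)"
      using Suc by (intro measurable_component_singleton) simp
    moreover have "(\<lambda>x. measure_pmf (P x (\<pi> x))) \<in>
        count_space UNIV \<rightarrow>\<^sub>M subprob_algebra (count_space (UNIV :: 's set))"
      by (simp add: measure_pmf_in_subprob_space)
    ultimately show ?thesis
      unfolding trajectory_step_def[abs_def] using Suc by (simp add: measurable_compose)
  qed
qed (simp add: trajectory_step_def prob_space_measure_pmf)

context
  fixes P :: "'s::finite \<Rightarrow> 'a \<Rightarrow> 's pmf" and \<pi> :: "'s \<Rightarrow> 'a" and s :: 's
begin

interpretation IT: Ionescu_Tulcea "trajectory_step P \<pi> s" "\<lambda>_. count_space UNIV"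
  by (rule Ionescu_Tulcea_trajectory_step)

text \<open>The transition matrix acts on functions as the one-step expectation. Nonnegative
  \<open>f\<close> allows the use of nonnegative integrals, in which kernels compose without
  integrability conditions.\<close>

lemma nn_integral_transition:
  assumes "\<And>x. 0 \<le> f $ x"
  shows "(\<integral>\<^sup>+x. ennreal (f $ x) \<partial>measure_pmf (P t (\<pi> t))) =
    ennreal ((transition_matrix P \<pi> *v f) $ t)"
  using assms
  by (subst nn_integral_measure_pmf_support[where A=UNIV])
    (simp_all add: transition_matrix_def matrix_vector_mult_def sum_nonneg
      ennreal_mult'[symmetric] mult.commute sum_ennreal)

text \<open>\<open>IT.C 0 (Suc n)\<close> is the law of the \<open>Suc n\<close> states at times 0
  to \<open>n\<close>. Integrating out the last state replaces \<open>f\<close> by its one-step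
  expectation one time earlier, so the induction must generalise over \<open>f\<close>.\<close>

lemma nn_integral_C_trajectory:
  assumes "\<And>x. 0 \<le> f $ x"
  shows "(\<integral>\<^sup>+\<omega>. ennreal (f $ \<omega> n) \<partial>IT.C 0 (Suc n) (\<lambda>_. undefined)) =
    ennreal ((matpow (transition_matrix P \<pi>) n *v f) $ s)"
  using assms
proof (induction n arbitrary: f)
  case 0
  have [measurable]: "(\<lambda>\<omega>. ennreal (f $ \<omega> 0)) \<in> borel_measurable (PiM {0..<Suc 0} (\<lambda>_. count_space UNIV))"
    by measurable
  \<comment> \<open>The empty history is the single point of the product over no
    coordinates.\<close>
  have u: "(\<lambda>_. undefined) \<in> space (PiM {0..<0} (\<lambda>_. count_space (UNIV :: 's set)))"
    by (simp add: space_PiM PiE_iff extensional_def)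
  have "IT.C 0 (Suc 0) (\<lambda>_. undefined) = IT.eP 0 (\<lambda>_. undefined)"
    using bind_return[OF IT.measurable_eP u] by simp
  then have "(\<integral>\<^sup>+\<omega>. ennreal (f $ \<omega> 0) \<partial>IT.C 0 (Suc 0) (\<lambda>_. undefined)) =
      (\<integral>\<^sup>+x. ennreal (f $ x) \<partial>trajectory_step P \<pi> s 0 (\<lambda>_. undefined))"
    using IT.nn_integral_eP[OF u, of "\<lambda>\<omega>. ennreal (f $ \<omega> 0)"] by simp
  also have "\<dots> = ennreal (f $ s)"
    by (simp add: trajectory_step_def)
  finally show ?case
    by simp
next
  case (Suc n)
  let ?u = "\<lambda>_::nat. undefined :: 's"
  let ?PM = "\<lambda>n. PiM {0..<n} (\<lambda>_. count_space (UNIV :: 's set))"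
  have [measurable]: "(\<lambda>\<omega>. ennreal (f $ \<omega> (Suc n))) \<in> borel_measurable (?PM (Suc (Suc n)))"
    by measurable
  have u: "?u \<in> space (?PM 0)"
    by (simp add: space_PiM PiE_iff extensional_def)
  have "(\<integral>\<^sup>+\<omega>. ennreal (f $ \<omega> (Suc n)) \<partial>IT.C 0 (Suc (Suc n)) ?u) =
      (\<integral>\<^sup>+\<omega>. \<integral>\<^sup>+\<omega>'. ennreal (f $ \<omega>' (Suc n)) \<partial>IT.eP (Suc n) \<omega> \<partial>IT.C 0 (Suc n) ?u)"
    unfolding IT.C.simps(2)[of 0 "Suc n"] add_0
    using IT.measurable_eP[of "Suc n"] IT.sets_C[OF u, of "Suc n"]
    by (intro nn_integral_bind[where B="?PM (Suc (Suc n))"])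
      (simp_all cong: measurable_cong_sets)
  also have "\<dots> = (\<integral>\<^sup>+\<omega>. ennreal ((transition_matrix P \<pi> *v f) $ \<omega> n) \<partial>IT.C 0 (Suc n) ?u)"
  proof (rule nn_integral_cong)
    fix \<omega> assume "\<omega> \<in> space (IT.C 0 (Suc n) ?u)"
    then have "\<omega> \<in> space (?PM (Suc n))"
      using IT.space_C[OF u, of "Suc n"] by simp
    then have "(\<integral>\<^sup>+\<omega>'. ennreal (f $ \<omega>' (Suc n)) \<partial>IT.eP (Suc n) \<omega>) =
        (\<integral>\<^sup>+x. ennreal (f $ x) \<partial>measure_pmf (P (\<omega> n) (\<pi> (\<omega> n))))"
      by (subst IT.nn_integral_eP) (simp_all add: trajectory_step_def)
    then show "(\<integral>\<^sup>+\<omega>'. ennreal (f $ \<omega>' (Suc n)) \<partial>IT.eP (Suc n) \<omega>) =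
        ennreal ((transition_matrix P \<pi> *v f) $ \<omega> n)"
      using nn_integral_transition Suc.prems by simp
  qed
  also have "\<dots> = ennreal ((matpow (transition_matrix P \<pi>) n *v (transition_matrix P \<pi> *v f)) $ s)"
    using Suc.prems
    by (intro Suc.IH) (simp add: transition_matrix_def matrix_vector_mult_def sum_nonneg)
  \<comment> \<open>The new factor stands next to \<open>f\<close>, to the right of the power,
    whereas \<open>matpow\<close> adds it on the left.\<close>
  also have "\<dots> = ennreal ((matpow (transition_matrix P \<pi>) (Suc n) *v f) $ s)"
    by (simp add: matrix_vector_mul_assoc matpow_commute)
  finally show ?case .
qed

section \<open>The infinite trajectory and its marginals\<close>

lemma sets_trajectory_measure:
  "sets (trajectory_measure P \<pi> s) = sets (PiM UNIV (\<lambda>_. count_space UNIV))"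
  unfolding trajectory_measure_def by (rule IT.PF.sets_lim)

lemma space_trajectory_measure: "space (trajectory_measure P \<pi> s) = UNIV"
  using sets_eq_imp_space_eq[OF sets_trajectory_measure] by (simp add: space_PiM)

text \<open>Push-forward preserves total mass, and the push-forward to the empty set of coordinates
  is a member of the projective family, hence a probability measure.\<close>

lemma prob_space_trajectory_measure: "prob_space (trajectory_measure P \<pi> s)"
  unfolding trajectory_measure_def
proof (rule prob_space_distrD)
  show "(\<lambda>\<omega>. restrict \<omega> {}) \<in> IT.PF.lim \<rightarrow>\<^sub>M PiM {} (\<lambda>_. count_space UNIV)"
    by (simp add: measurable_cong_sets[OF IT.PF.sets_lim refl])
  show "prob_space (distr IT.PF.lim (PiM {} (\<lambda>_. count_space UNIV)) (\<lambda>\<omega>. restrict \<omega> {}))"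
    using IT.distr_lim[of "{}"] IT.PF.prob_space_P[of "{}"] by simp
qed

lemma measurable_trajectory_component [measurable]:
  "(\<lambda>\<omega>. \<omega> n) \<in> trajectory_measure P \<pi> s \<rightarrow>\<^sub>M count_space UNIV"
  unfolding measurable_cong_sets[OF sets_trajectory_measure refl]
  by (rule measurable_component_singleton) simp

lemma measure_trajectory_component:
  "measure (trajectory_measure P \<pi> s) {\<omega>. \<omega> n = x} = matpow (transition_matrix P \<pi>) n $ s $ x"
proof -
  let ?u = "\<lambda>_::nat. undefined :: 's"
  let ?M = "\<lambda>_::nat. count_space (UNIV :: 's set)"
  let ?X = "{\<omega> \<in> space (PiM {0..<Suc n} ?M). \<omega> n = x}"
  have X: "?X \<in> sets (PiM {0..<Suc n} ?M)"
    by measurable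
  have u: "?u \<in> space (PiM {0..<0} ?M)"
    by (simp add: space_PiM PiE_iff extensional_def)
  \<comment> \<open>The event is a cylinder over the coordinates up to \<open>n\<close>, so its mass
    is already determined by the finite-horizon law.\<close>
  have emb: "{\<omega>. \<omega> n = x} = prod_emb UNIV ?M {0..<Suc n} ?X"
    by (auto simp: prod_emb_def space_PiM)
  have "emeasure (trajectory_measure P \<pi> s) {\<omega>. \<omega> n = x} = emeasure (IT.CI {0..<Suc n}) ?X"
    unfolding trajectory_measure_def emb using X by (intro IT.lim) simp_all
  also have "\<dots> = emeasure (IT.C 0 (Suc n) ?u) (prod_emb {0..<Suc n} ?M {0..<Suc n} ?X)"
    using X by (intro IT.emeasure_CI) simp_all
  also have "prod_emb {0..<Suc n} ?M {0..<Suc n} ?X = ?X"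
    using X by (intro prod_emb_id) (auto dest: sets.sets_into_space simp: space_PiM)
  also have "emeasure (IT.C 0 (Suc n) ?u) ?X =
      (\<integral>\<^sup>+\<omega>. indicator ?X \<omega> \<partial>IT.C 0 (Suc n) ?u)"
    using X IT.sets_C[OF u, of "Suc n"] by simp
  \<comment> \<open>The indicator of state \<open>x\<close> is the basis vector at \<open>x\<close>;
    applying the matrix power to it selects column \<open>x\<close>.\<close>
  also have "\<dots> = (\<integral>\<^sup>+\<omega>. ennreal (axis x 1 $ \<omega> n) \<partial>IT.C 0 (Suc n) ?u)"
    using IT.space_C[OF u, of "Suc n"]
    by (intro nn_integral_cong) (auto simp: axis_def indicator_def)
  also have "\<dots> = ennreal ((matpow (transition_matrix P \<pi>) n *v axis x 1) $ s)"
    by (intro nn_integral_C_trajectory) (simp add: axis_def)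
  also have "\<dots> = ennreal (matpow (transition_matrix P \<pi>) n $ s $ x)"
    by (simp add: matrix_vector_mult_basis column_def)
  finally show ?thesis
    using row_stochastic_matpow[OF row_stochastic_transition_matrix, of P \<pi> n]
    by (simp add: measure_def row_stochastic_def)
qed

section \<open>Expected rewards and the value function\<close>

lemma integrable_trajectory_component:
  "integrable (trajectory_measure P \<pi> s) (\<lambda>\<omega>. f (\<omega> n) :: real)"
proof -
  interpret prob_space "trajectory_measure P \<pi> s"
    by (rule prob_space_trajectory_measure)
  show ?thesis
    by (rule integrable_const_bound[where B="Max (range (\<lambda>x. \<bar>f x\<bar>))"]) auto
qed

lemma integral_trajectory_component:
  "(\<integral>\<omega>. r $ \<omega> n \<partial>trajectory_measure P \<pi> s) = (matpow (transition_matrix P \<pi>) n *v r) $ s"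
proof -
  interpret prob_space "trajectory_measure P \<pi> s"
    by (rule prob_space_trajectory_measure)
  have sets: "{\<omega>. \<omega> n = x} \<in> events" for x
    using measurable_sets[OF measurable_trajectory_component, of "{x}" n]
    by (simp add: space_trajectory_measure vimage_def)
  \<comment> \<open>With finitely many states the reward is a finite combination of indicators of
    the events just measured.\<close>
  have "(\<integral>\<omega>. r $ \<omega> n \<partial>trajectory_measure P \<pi> s) =
      (\<integral>\<omega>. (\<Sum>x\<in>UNIV. r $ x * indicator {\<omega>. \<omega> n = x} \<omega>) \<partial>trajectory_measure P \<pi> s)"
    by (simp add: indicator_def if_distrib cong: if_cong)
  also have "\<dots> = (\<Sum>x\<in>UNIV. r $ x * prob {\<omega>. \<omega> n = x})"
    using sets by (subst Bochner_Integration.integral_sum) (auto simp: space_trajectory_measure less_top[symmetric])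
  finally show ?thesis
    by (simp add: measure_trajectory_component matrix_vector_mult_def mult.commute)
qed

text \<open>The expectation is taken inside the discounted sum, where the reward at time
  \<open>t + 1\<close> has mean given by the matrix power \<open>t + 1\<close>; the sum is then the
  successor measure applied to \<open>r\<close>.\<close>

lemma value_function_eq:
  assumes "0 \<le> \<gamma>" "\<gamma> < 1"
  shows "value_function P \<gamma> \<pi> r s = (successor_measure P \<gamma> \<pi> *v r) $ s"
proof -
  let ?N = "trajectory_measure P \<pi> s"
  interpret prob_space ?N
    by (rule prob_space_trajectory_measure)
  \<comment> \<open>Being uniform in the state, this bound yields both absolute convergence on every
    trajectory and summability of the integrated norms, the two conditions for the exchange.\<close>
  have le: "norm (\<gamma> ^ t * r $ x) \<le> \<gamma> ^ t * norm r" for t x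
    using assms component_le_norm_cart[of r x] by (simp add: abs_mult mult_left_mono)
  have summable_bound: "summable (\<lambda>t. \<gamma> ^ t * norm r)"
    using assms by (intro summable_mult2 summable_geometric) simp
  have "summable (\<lambda>t. \<integral>\<omega>. norm (\<gamma> ^ t * r $ \<omega> (t + 1)) \<partial>?N)"
  proof (rule summable_comparison_test'[OF summable_bound])
    fix t
    have "(\<integral>\<omega>. norm (\<gamma> ^ t * r $ \<omega> (t + 1)) \<partial>?N) \<le> (\<integral>\<omega>. \<gamma> ^ t * norm r \<partial>?N)"
      by (intro integral_mono le integrable_trajectory_component)
    then show "norm (\<integral>\<omega>. norm (\<gamma> ^ t * r $ \<omega> (t + 1)) \<partial>?N) \<le> \<gamma> ^ t * norm r"
      by (simp add: prob_space)
  qed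
  moreover have "summable (\<lambda>t. norm (\<gamma> ^ t * r $ \<omega> (t + 1)))" for \<omega> :: "nat \<Rightarrow> 's"
    by (rule summable_comparison_test'[OF summable_bound]) (simp add: le[simplified])
  ultimately have "value_function P \<gamma> \<pi> r s = (\<Sum>t. \<integral>\<omega>. \<gamma> ^ t * r $ \<omega> (t + 1) \<partial>?N)"
    unfolding value_function_def
    by (intro integral_suminf integrable_trajectory_component) simp_all
  also have "\<dots> = (\<Sum>t. ((\<gamma> ^ t *\<^sub>R matpow (transition_matrix P \<pi>) (t + 1)) *v r) $ s)"
    by (simp add: integral_trajectory_component scaleR_matrix_vector_assoc[symmetric] del: matpow.simps)
  also have "\<dots> = (successor_measure P \<gamma> \<pi> *v r) $ s"
    unfolding successor_measure_def
  proof (rule bounded_linear.suminf[symmetric, OF _ summable_Neumann])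
    \<comment> \<open>Evaluation at \<open>r\<close> and \<open>s\<close> is continuous in the
      matrix, so it passes through the matrix series.\<close>
    show "bounded_linear (\<lambda>A :: real ^ 's ^ 's. (A *v r) $ s)"
      by (rule bounded_linear_intro[where K="norm r"])
        (simp_all add: matrix_vector_mult_add_rdistrib scaleR_matrix_vector_assoc[symmetric]
          order_trans[OF component_le_norm_cart norm_matrix_vector_mult_le, unfolded real_norm_def])
  qed (use assms row_stochastic_transition_matrix in auto)
  finally show ?thesis .
qed

end

subsection \<open>The losses\<close>

lemma expectation_finite:
  fixes f :: "'z::finite \<Rightarrow> real"
  shows "measure_pmf.expectation p f = (\<Sum>z\<in>UNIV. pmf p z * f z)"
  by (subst integral_measure_pmf[where A=UNIV]) simp_all

lemma expectation_finite_mono: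
  fixes f g :: "'z::finite \<Rightarrow> real"
  assumes "\<And>z. f z \<le> g z"
  shows "measure_pmf.expectation p f \<le> measure_pmf.expectation p g"
  unfolding expectation_finite using assms by (intro sum_mono mult_left_mono) auto

text \<open>The sum of all squared factors dominates each of them, so it leaves the expectation as a
  constant that depends on \<open>k\<close> alone.\<close>

lemma expectation_norm_squared_le:
  fixes p :: "'z::finite pmf" and f :: "'z \<Rightarrow> 'b::real_normed_vector" and g :: "'z \<Rightarrow> 'c::real_normed_vector"
  assumes "\<And>z. norm (f z) \<le> k z * norm (g z)"
  shows "measure_pmf.expectation p (\<lambda>z. (norm (f z))\<^sup>2) \<le>
    (\<Sum>z\<in>UNIV. (k z)\<^sup>2) * measure_pmf.expectation p (\<lambda>z. (norm (g z))\<^sup>2)"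
proof -
  have "measure_pmf.expectation p (\<lambda>z. (norm (f z))\<^sup>2) \<le>
      measure_pmf.expectation p (\<lambda>z. (\<Sum>z\<in>UNIV. (k z)\<^sup>2) * (norm (g z))\<^sup>2)"
  proof (rule expectation_finite_mono)
    fix z
    have "(norm (f z))\<^sup>2 \<le> (k z)\<^sup>2 * (norm (g z))\<^sup>2"
      using power_mono[OF assms[of z], of 2] by (simp add: power_mult_distrib)
    also have "\<dots> \<le> (\<Sum>z\<in>UNIV. (k z)\<^sup>2) * (norm (g z))\<^sup>2"
      by (intro mult_right_mono member_le_sum) auto
    finally show "(norm (f z))\<^sup>2 \<le> (\<Sum>z\<in>UNIV. (k z)\<^sup>2) * (norm (g z))\<^sup>2" .
  qed
  then show ?thesis
    by simp
qed

lemma regression_weight_orthonormal: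
  assumes "transpose \<psi> ** \<psi> = mat 1"
  shows "regression_weight \<psi> r = transpose \<psi> *v r"
proof -
  \<comment> \<open>\<open>matrix_inv\<close> is a choice, so its value is pinned down by uniqueness
    of the inverse.\<close>
  have "matrix_inv (mat 1 :: real ^ 'a ^ 'a) = mat 1"
    unfolding matrix_inv_def by (rule some_equality) simp_all
  then show ?thesis
    unfolding regression_weight_def assms by simp
qed

text \<open>Both the value and its approximation are coordinate \<open>s\<close> of a matrix applied
  to \<open>r\<close>, so the sum over states is a squared Euclidean norm.\<close>

lemma value_error_eq:
  fixes P :: "'s::finite \<Rightarrow> 'a \<Rightarrow> 's pmf"
  assumes "0 \<le> \<gamma>" "\<gamma> < 1" and "transpose \<psi> ** \<psi> = mat 1"
  shows "value_error P \<gamma> p \<pi> \<phi> T \<psi> r = measure_pmf.expectation p (\<lambda>z.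
    (norm ((successor_measure P \<gamma> (\<pi> z) - \<phi> ** T z ** transpose \<psi>) *v r))\<^sup>2)"
proof -
  have "row s \<phi> \<bullet> (T z *v (transpose \<psi> *v r)) = ((\<phi> ** T z ** transpose \<psi>) *v r) $ s" for s z
    by (simp add: matrix_vector_mul_assoc[symmetric] matrix_vector_mul_component row_def
        del: transpose_matrix_vector)
  moreover have "(norm x)\<^sup>2 = (\<Sum>s\<in>UNIV. (x $ s)\<^sup>2)" for x :: "real ^ 's"
    unfolding power2_norm_eq_inner inner_vec_def by (simp add: power2_eq_square)
  ultimately show ?thesis
    unfolding value_error_def regression_weight_orthonormal[OF assms(3)]
    by (simp add: value_function_eq[OF assms(1,2)] matrix_vector_mult_diff_rdistrib
        del: transpose_matrix_vector)
qed

theorem theorem4: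
  fixes P :: "'s::finite \<Rightarrow> 'a \<Rightarrow> 's pmf"
    and \<gamma> :: real
    and p :: "'z::finite pmf"
    and \<pi> :: "'z \<Rightarrow> 's \<Rightarrow> 'a"
  assumes "0 \<le> \<gamma>" and "\<gamma> < 1"
  shows
    "(\<forall>(\<phi> :: real ^ 'd ^ 's) (\<psi> :: real ^ 'e ^ 's) (T :: 'z \<Rightarrow> real ^ 'e ^ 'd).
        transpose \<phi> ** \<phi> = mat 1 \<longrightarrow> transpose \<psi> ** \<psi> = mat 1 \<longrightarrow>
        (\<exists>r. is_arg_max (value_error P \<gamma> p \<pi> \<phi> T \<psi>) (\<lambda>r. norm r \<le> 1) r
           \<and> value_error P \<gamma> p \<pi> \<phi> T \<psi> r \<le> 2 * loss_SM P \<gamma> p \<pi> \<phi> T \<psi>)) \<and>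
     (\<exists>c. \<forall>(\<phi> :: real ^ 'd ^ 's) (\<psi> :: real ^ 'e ^ 's) (T :: 'z \<Rightarrow> real ^ 'e ^ 'd).
        transpose \<phi> ** \<phi> = mat 1 \<longrightarrow> transpose \<psi> ** \<psi> = mat 1 \<longrightarrow>
        loss_SM P \<gamma> p \<pi> \<phi> T \<psi> \<le> c * loss_fw P \<gamma> p \<pi> \<phi> T \<psi> \<and>
        loss_SM P \<gamma> p \<pi> \<phi> T \<psi> \<le> c * loss_bw P \<gamma> p \<pi> \<phi> (\<lambda>z. transpose (T z)) \<psi>)"
proof (intro conjI allI impI)
  fix \<phi> :: "real ^ 'd ^ 's" and \<psi> :: "real ^ 'e ^ 's" and T :: "'z \<Rightarrow> real ^ 'e ^ 'd"
  assume "transpose \<psi> ** \<psi> = mat 1"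
  define D where "D z = \<phi> ** T z ** transpose \<psi> - successor_measure P \<gamma> (\<pi> z)" for z
  have "D z = - (successor_measure P \<gamma> (\<pi> z) - \<phi> ** T z ** transpose \<psi>)" for z
    by (simp add: D_def)
  then have err: "value_error P \<gamma> p \<pi> \<phi> T \<psi> r = measure_pmf.expectation p (\<lambda>z. (norm (D z *v r))\<^sup>2)" for r
    using \<open>transpose \<psi> ** \<psi> = mat 1\<close>
    by (simp add: value_error_eq assms matrix_vector_mult_diff_rdistrib norm_minus_commute D_def)
  \<comment> \<open>A finite weighted sum of squared norms of linear images of \<open>r\<close>;
    compactness of the unit ball then provides a maximiser.\<close>
  have "continuous_on (cball 0 1) (value_error P \<gamma> p \<pi> \<phi> T \<psi>)"
    unfolding err expectation_finite
    by (intro continuous_intros linear_continuous_on matrix_vector_mul_bounded_linear)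
  from continuous_attains_sup[OF compact_cball _ this]
  obtain r where "norm r \<le> 1"
    and max: "\<And>y. norm y \<le> 1 \<Longrightarrow> value_error P \<gamma> p \<pi> \<phi> T \<psi> y \<le> value_error P \<gamma> p \<pi> \<phi> T \<psi> r"
    by auto
  have "norm (D z *v r) \<le> norm (D z)" for z
    using norm_matrix_vector_mult_le[of "D z" r] mult_left_mono[OF \<open>norm r \<le> 1\<close>, of "norm (D z)"] by simp
  then have "value_error P \<gamma> p \<pi> \<phi> T \<psi> r \<le> 2 * loss_SM P \<gamma> p \<pi> \<phi> T \<psi>"
    unfolding err loss_SM_def D_def[symmetric] by (simp add: expectation_finite_mono power_mono)
  moreover have "is_arg_max (value_error P \<gamma> p \<pi> \<phi> T \<psi>) (\<lambda>r. norm r \<le> 1) r"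
    using \<open>norm r \<le> 1\<close> max by (auto simp: is_arg_max_def not_less)
  ultimately show "\<exists>r. is_arg_max (value_error P \<gamma> p \<pi> \<phi> T \<psi>) (\<lambda>r. norm r \<le> 1) r
      \<and> value_error P \<gamma> p \<pi> \<phi> T \<psi> r \<le> 2 * loss_SM P \<gamma> p \<pi> \<phi> T \<psi>"
    by blast
next
  define N where "N z = mat 1 + \<gamma> *\<^sub>R successor_measure P \<gamma> (\<pi> z)" for z
  \<comment> \<open>\<open>N z\<close> is the inverse of the identity minus \<gamma> times the
    transition matrix of \<open>\<pi> z\<close>, so \<open>c\<close> is fixed before \<phi>, \<psi>
    and \<open>T\<close> and serves both losses.\<close>
  define c where "c = (\<Sum>z\<in>UNIV. (norm (N z))\<^sup>2)"
  note residual = Bellman_residual[OF row_stochastic_transition_matrix assms,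
      folded successor_measure_def]
  have "loss_SM P \<gamma> p \<pi> \<phi> T \<psi> \<le> c * loss_fw P \<gamma> p \<pi> \<phi> T \<psi>"
    for \<phi> :: "real ^ 'd ^ 's" and \<psi> :: "real ^ 'e ^ 's" and T
  proof -
    let ?R = "\<lambda>z. \<phi> ** T z ** transpose \<psi> - transition_matrix P (\<pi> z)
      - \<gamma> *\<^sub>R (transition_matrix P (\<pi> z) ** \<phi> ** T z ** transpose \<psi>)"
    have "norm (\<phi> ** T z ** transpose \<psi> - successor_measure P \<gamma> (\<pi> z)) \<le> norm (N z) * norm (?R z)" for z
    proof -
      have "N z ** ?R z = \<phi> ** T z ** transpose \<psi> - successor_measure P \<gamma> (\<pi> z)"
        using residual(1)[of P "\<pi> z" "\<phi> ** T z ** transpose \<psi>"]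
        by (simp add: N_def matrix_mul_assoc)
      then show ?thesis
        using norm_matrix_matrix_mult_le[of "N z" "?R z"] by simp
    qed
    from expectation_norm_squared_le[OF this] show ?thesis
      unfolding loss_SM_def loss_fw_def c_def by simp
  qed
  moreover have "loss_SM P \<gamma> p \<pi> \<phi> T \<psi> \<le> c * loss_bw P \<gamma> p \<pi> \<phi> (\<lambda>z. transpose (T z)) \<psi>"
    for \<phi> :: "real ^ 'd ^ 's" and \<psi> :: "real ^ 'e ^ 's" and T
  proof -
    let ?R = "\<lambda>z. \<psi> ** transpose (T z) ** transpose \<phi> - transpose (transition_matrix P (\<pi> z))
      - \<gamma> *\<^sub>R (transpose (transition_matrix P (\<pi> z)) ** \<psi> ** transpose (T z) ** transpose \<phi>)"
    have "norm (\<phi> ** T z ** transpose \<psi> - successor_measure P \<gamma> (\<pi> z)) \<le> norm (N z) * norm (?R z)" for z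
    proof -
      let ?X = "\<phi> ** T z ** transpose \<psi>" and ?A = "transition_matrix P (\<pi> z)"
      \<comment> \<open>Transposition keeps the Frobenius norm and moves the transition matrix to
        the right of \<open>?X\<close>, where the second residual identity applies.\<close>
      have R: "transpose (?R z) = ?X - ?A - \<gamma> *\<^sub>R (?X ** ?A)"
        by (simp add: transpose_diff transpose_scalar matrix_transpose_mul matrix_mul_assoc)
      have "transpose (?R z) ** N z = ?X - successor_measure P \<gamma> (\<pi> z)"
        unfolding R N_def by (rule residual(2))
      then show ?thesis
        using norm_matrix_matrix_mult_le[of "transpose (?R z)" "N z"]
        unfolding norm_transpose by (simp add: mult.commute)
    qed
    from expectation_norm_squared_le[OF this] show ?thesis
      unfolding loss_SM_def loss_bw_def c_def by simp
  qed
  ultimately show "\<exists>c. \<forall>(\<phi> :: real ^ 'd ^ 's) (\<psi> :: real ^ 'e ^ 's) (T :: 'z \<Rightarrow> real ^ 'e ^ 'd).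
        transpose \<phi> ** \<phi> = mat 1 \<longrightarrow> transpose \<psi> ** \<psi> = mat 1 \<longrightarrow>
        loss_SM P \<gamma> p \<pi> \<phi> T \<psi> \<le> c * loss_fw P \<gamma> p \<pi> \<phi> T \<psi> \<and>
        loss_SM P \<gamma> p \<pi> \<phi> T \<psi> \<le> c * loss_bw P \<gamma> p \<pi> \<phi> (\<lambda>z. transpose (T z)) \<psi>"
    by blast
qed

end
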